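(* Let $d\in\mathbb N$, $a\in\mathbb N_0$. For every $n\in\mathbb N_0$, as polynomials in $x$, $$x^n=\sum_{m=0}^n\widehat{S2}(d,a;n,m)\,\mathrm{fallfac}(d,a;x,m).$$
   Context: $\mathbb N=\{1,2,\dots\}$, $\mathbb N_0=\{0,1,2,\dots\}$. The generalized Stirling numbers of the second kind $S2(d,a;n,m)$, $0\le m\le n$, are defined by the operator identity $(a\,\mathbf 1+d\,\mathbf E_x)^n=\sum_{m=0}^n S2(d,a;n,m)\,x^m\,\mathbf d_x^{\,m}$, where $\mathbf d_x$ is differentiation with respect to $x$, $\mathbf E_x:=x\,\mathbf d_x$ and $\mathbf 1$ is the identity operator. The scaled numbers are $\widehat{S2}(d,a;n,m):=S2(d,a;n,m)/d^m$. The generalized falling factorials are $\mathrm{fallfac}(d,a;x,m):=\prod_{j=0}^{m-1}\big(x-(a+j\,d)\big)$ for $m\ge1$, and $\mathrm{fallfac}(d,a;x,0):=1$. *)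

theory Defs
  imports "HOL-Computational_Algebra.Polynomial"
begin

definition X :: "rat poly" where
  "X = [:0, 1:]"

definition euler_op :: "rat poly \<Rightarrow> rat poly" where
  "euler_op p = X * pderiv p"

definition aE_op :: "nat \<Rightarrow> nat \<Rightarrow> rat poly \<Rightarrow> rat poly" where
  "aE_op d a p = smult (of_nat a) p + smult (of_nat d) (euler_op p)"

text \<open>The operators act on the rational polynomials in x, which suffices to determine
  the coefficients of a normally ordered differential operator. The array is indexed by
  all natural numbers m; it is set to 0 outside the range m at most n, where
  the operator identity says nothing.\<close>

definition S2 :: "nat \<Rightarrow> nat \<Rightarrow> nat \<Rightarrow> nat \<Rightarrow> rat" where
  "S2 d a n = (THE c. (\<forall>m>n. c m = 0) \<and>
     (\<forall>p. (aE_op d a ^^ n) p = (\<Sum>m=0..n. smult (c m) (X ^ m * (pderiv ^^ m) p))))"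

definition S2hat :: "nat \<Rightarrow> nat \<Rightarrow> nat \<Rightarrow> nat \<Rightarrow> rat" where
  "S2hat d a n m = S2 d a n m / of_nat d ^ m"

definition fallfac :: "nat \<Rightarrow> nat \<Rightarrow> 'a::comm_ring_1 \<Rightarrow> nat \<Rightarrow> 'a" where
  "fallfac d a x m = (\<Prod>j<m. x - of_nat (a + j * d))"

end

theory Submission imports Defs begin

text \<open>Applying the normal ordering identity to the monomial \<open>x\<^sup>k\<close>, an eigenvector of both
  sides, yields \<open>(a + d k)\<^sup>n = (\<Sum>m\<le>n. S2 d a n m * (k (k-1) \<dots> (k-m+1)))\<close>. Since
  \<open>d\<^sup>m k (k-1) \<dots> (k-m+1)\<close> is the generalized falling factorial at \<open>x = a + d k\<close>, the two
  polynomials of the theorem agree at the infinitely many points \<open>a + d k\<close>. The same evaluation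
  at monomials is triangular in the coefficients, which makes them unique.\<close>

text \<open>The product rule. With \<open>q\<close> an iterated derivative it moves
  \<open>euler_op\<close> past \<open>X ^ m\<close>, the basic step of normal ordering; with
  \<open>q = 1\<close> it makes the powers of x eigenvectors.\<close>

lemma euler_op_X_power_mult:
  "euler_op (X ^ m * q) = smult (of_nat m) (X ^ m * q) + X ^ Suc m * pderiv q"
proof (cases m)
  case 0
  then show ?thesis by (simp add: euler_op_def)
next
  case (Suc l)
  have "pderiv X = 1"
    by (simp add: X_def pderiv_pCons)
  then have deriv: "pderiv (X ^ Suc l) = smult (of_nat (Suc l)) (X ^ l)"
    by (simp only: pderiv_power_Suc mult_1_right)
  have "euler_op (X ^ Suc l * q)
      = X * (smult (of_nat (Suc l)) (X ^ l) * q) + X * (X ^ Suc l * pderiv q)"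
    unfolding euler_op_def pderiv_mult deriv by (simp only: distrib_left ac_simps)
  also have "\<dots> = smult (of_nat (Suc l)) (X ^ Suc l * q) + X ^ Suc (Suc l) * pderiv q"
    by (simp only: mult_smult_left mult_smult_right power_Suc mult.assoc)
  finally show ?thesis unfolding Suc .
qed

lemma euler_op_X_power: "euler_op (X ^ k) = smult (of_nat k) (X ^ k)"
  using euler_op_X_power_mult[of k 1] by simp

lemma aE_op_X_power: "aE_op d a (X ^ k) = smult (of_nat (a + d * k)) (X ^ k)"
  by (simp add: aE_op_def euler_op_X_power smult_add_left)

lemma aE_op_smult: "aE_op d a (smult c p) = smult c (aE_op d a p)"
  by (simp add: aE_op_def euler_op_def pderiv_smult smult_add_right mult.commute)

lemma aE_op_sum: "aE_op d a (sum f A) = (\<Sum>i\<in>A. aE_op d a (f i))"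
  by (induction A rule: infinite_finite_induct)
    (simp_all add: aE_op_def euler_op_def pderiv_add smult_add_right distrib_left)

lemma aE_op_funpow_X_power:
  "(aE_op d a ^^ n) (X ^ k) = smult (of_nat (a + d * k) ^ n) (X ^ k)"
  by (induction n) (simp_all add: aE_op_smult aE_op_X_power mult.commute del: of_nat_add of_nat_mult)

text \<open>With E = \<open>euler_op\<close> and D = \<open>pderiv\<close>, the operator x^m D^m
  factors as E (E - 1) ... (E - m + 1), and E acts on x^k as the scalar k.\<close>

lemma X_power_mult_pderiv_funpow_X_power:
  "X ^ m * (pderiv ^^ m) (X ^ k) = smult (fallfac 1 0 (of_nat k) m) (X ^ k)"
proof (induction m)
  case 0
  then show ?case by (simp add: fallfac_def)
next
  case (Suc m)
  let ?q = "X ^ m * (pderiv ^^ m) (X ^ k)"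
  have "X ^ Suc m * (pderiv ^^ Suc m) (X ^ k) = euler_op ?q - smult (of_nat m) ?q"
    by (simp add: euler_op_X_power_mult)
  \<comment> \<open>By the induction hypothesis \<open>?q\<close> is a scalar multiple of x^k, hence
    satisfies the same eigenvalue equation.\<close>
  also have "euler_op ?q = smult (of_nat k) ?q"
    using euler_op_X_power[of k] unfolding Suc.IH
    by (simp add: euler_op_def pderiv_smult mult.commute)
  also have "smult (of_nat k) ?q - smult (of_nat m) ?q = smult (of_nat k - of_nat m) ?q"
    by (simp add: smult_diff_left)
  finally show ?case
    unfolding Suc.IH by (simp add: fallfac_def mult.commute)
qed

text \<open>One more \<open>aE_op\<close> turns x^m D^m into (a + d m) x^m D^m + d x^(m+1) D^(m+1),
  so normal order is preserved.\<close>

lemma aE_op_normal_order_exists: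
  "\<exists>c. (\<forall>m>n. c m = 0) \<and>
     (\<forall>p. (aE_op d a ^^ n) p = (\<Sum>m=0..n. smult (c m) (X ^ m * (pderiv ^^ m) p)))"
proof (induction n)
  case 0
  show ?case by (rule exI[of _ "\<lambda>m. if m = 0 then 1 else 0"]) simp
next
  case (Suc n)
  then obtain c where c: "\<And>m. m > n \<Longrightarrow> c m = 0"
    and op: "\<And>p. (aE_op d a ^^ n) p = (\<Sum>m=0..n. smult (c m) (X ^ m * (pderiv ^^ m) p))"
    by blast
  \<comment> \<open>\<open>b m\<close> is the contribution passed up from index m - 1, so none at m
    = 0; \<open>c'\<close> is then the Stirling-type recurrence c'(m) = (a + d m) c(m) + d c(m -
    1).\<close>
  define b where "b m = (if m = 0 then 0 else of_nat d * c (m - 1))" for m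
  define c' where "c' m = of_nat (a + d * m) * c m + b m" for m
  have "(aE_op d a ^^ Suc n) p = (\<Sum>m=0..Suc n. smult (c' m) (X ^ m * (pderiv ^^ m) p))" for p
  proof -
    let ?t = "\<lambda>m. X ^ m * (pderiv ^^ m) p"
    have step: "aE_op d a (?t m) = smult (of_nat (a + d * m)) (?t m) + smult (of_nat d) (?t (Suc m))"
      for m
      by (simp add: aE_op_def euler_op_X_power_mult smult_add_left smult_add_right)
    have "(aE_op d a ^^ Suc n) p = (\<Sum>m=0..n. smult (c m) (aE_op d a (?t m)))"
      by (simp add: op aE_op_sum aE_op_smult)
    also have "\<dots> = (\<Sum>m=0..n. smult (of_nat (a + d * m) * c m) (?t m))
        + (\<Sum>m=0..n. smult (b (Suc m)) (?t (Suc m)))"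
      unfolding step b_def sum.distrib[symmetric]
      by (intro sum.cong refl) (simp add: smult_add_right mult.commute del: of_nat_add of_nat_mult)
    also have "(\<Sum>m=0..n. smult (b (Suc m)) (?t (Suc m))) = (\<Sum>m=0..Suc n. smult (b m) (?t m))"
      by (subst sum.atLeast0_atMost_Suc_shift) (simp add: b_def)
    \<comment> \<open>The added top term vanishes because \<open>c\<close> is 0 beyond n.\<close>
    also have "(\<Sum>m=0..n. smult (of_nat (a + d * m) * c m) (?t m))
        = (\<Sum>m=0..Suc n. smult (of_nat (a + d * m) * c m) (?t m))"
      by (simp add: c)
    finally show ?thesis
      unfolding c'_def smult_add_left sum.distrib .
  qed
  moreover have "\<forall>m>Suc n. c' m = 0"
    by (auto simp: c'_def b_def c)
  ultimately show ?case by blast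
qed

lemma normal_order_eval_X_power:
  assumes "\<forall>p. (aE_op d a ^^ n) p = (\<Sum>m=0..n. smult (c m) (X ^ m * (pderiv ^^ m) p))"
  shows "of_nat (a + d * k) ^ n = (\<Sum>m=0..n. c m * fallfac 1 0 (of_nat k) m)"
proof -
  have "smult (of_nat (a + d * k) ^ n) (X ^ k)
      = (\<Sum>m=0..n. smult (c m) (smult (fallfac 1 0 (of_nat k) m) (X ^ k)))"
    using assms[rule_format, of "X ^ k"]
    unfolding aE_op_funpow_X_power X_power_mult_pderiv_funpow_X_power .
  \<comment> \<open>Evaluation at 1 turns the common factor \<open>X ^ k\<close> into 1 and leaves
    the scalars.\<close>
  from arg_cong[OF this, of "\<lambda>p. poly p 1"] show ?thesis
    by (simp add: poly_sum X_def)
qed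

lemma fallfac_of_nat_eq_0_iff:
  "fallfac 1 0 (of_nat k :: 'a::{idom, ring_char_0}) m = 0 \<longleftrightarrow> k < m"
  by (auto simp: fallfac_def)

text \<open>The falling factorial of k vanishes for m > k but not for m = k. Once the coefficients
  below k agree, the equation at k therefore isolates the one of index k.\<close>

lemma sum_fallfac_coeffs_unique:
  fixes b c :: "nat \<Rightarrow> 'a::{idom, ring_char_0}"
  assumes eq: "\<And>k. (\<Sum>m=0..n. b m * fallfac 1 0 (of_nat k) m)
      = (\<Sum>m=0..n. c m * fallfac 1 0 (of_nat k) m)"
    and "k \<le> n"
  shows "b k = c k"
  using \<open>k \<le> n\<close>
proof (induction k rule: less_induct)
  case (less k)
  let ?f = "\<lambda>m. (b m - c m) * fallfac 1 0 (of_nat k) m"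
  have "0 = (\<Sum>m=0..n. ?f m)"
    using eq[of k] by (simp add: left_diff_distrib sum_subtractf)
  also have "\<dots> = (\<Sum>m\<in>{k}. ?f m)"
  proof (rule sum.mono_neutral_right)
    show "\<forall>m\<in>{0..n} - {k}. ?f m = 0"
    proof
      fix m assume "m \<in> {0..n} - {k}"
      then show "?f m = 0"
        using less.IH[of m] fallfac_of_nat_eq_0_iff[of k m, where 'a = 'a] by (cases "m < k") auto
    qed
  qed (use less.prems in auto)
  finally show ?case
    using fallfac_of_nat_eq_0_iff[of k k, where 'a = 'a] by simp
qed

text \<open>The definite description in \<open>S2\<close> yields its defining property only after
  existence and uniqueness are established.\<close>

lemma S2_normal_order:
  "(aE_op d a ^^ n) p = (\<Sum>m=0..n. smult (S2 d a n m) (X ^ m * (pderiv ^^ m) p))"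
proof -
  let ?P = "\<lambda>c. (\<forall>m>n. c m = 0) \<and>
     (\<forall>p. (aE_op d a ^^ n) p = (\<Sum>m=0..n. smult (c m) (X ^ m * (pderiv ^^ m) p)))"
  have "\<exists>!c. ?P c"
  proof (rule ex_ex1I)
    show "\<exists>c. ?P c" by (rule aE_op_normal_order_exists)
  next
    fix b c assume b: "?P b" and c: "?P c"
    show "b = c"
    proof
      fix k
      show "b k = c k"
      proof (cases "k \<le> n")
        case True
        show ?thesis
        proof (rule sum_fallfac_coeffs_unique[OF _ True])
          fix j
          show "(\<Sum>m=0..n. b m * fallfac 1 0 (of_nat j) m)
              = (\<Sum>m=0..n. c m * fallfac 1 0 (of_nat j) m)"
            by (rule trans[OF normal_order_eval_X_power[OF conjunct2[OF b], symmetric]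
                  normal_order_eval_X_power[OF conjunct2[OF c]]])
        qed
      next
        \<comment> \<open>Beyond n the operator identity is silent; the convention of value 0 makes
          the two arrays agree there.\<close>
        case False
        then show ?thesis using b c by simp
      qed
    qed
  qed
  from theI'[OF this] show ?thesis
    unfolding S2_def by blast
qed

text \<open>At x = a + d k each factor x - (a + j d) equals d (k - j).\<close>

lemma fallfac_arith_progression:
  "fallfac d a (of_nat (a + d * k) :: 'a::comm_ring_1) m = of_nat d ^ m * fallfac 1 0 (of_nat k) m"
proof -
  have "fallfac d a (of_nat (a + d * k) :: 'a) m = (\<Prod>j<m. of_nat d * (of_nat k - of_nat j))"
    unfolding fallfac_def by (intro prod.cong refl) (simp add: algebra_simps)
  then show ?thesis by (simp add: fallfac_def prod.distrib)
qed

lemma poly_fallfac: "poly (fallfac d a p m) y = fallfac d a (poly p y) m"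
  by (simp add: fallfac_def poly_prod)

lemma poly_eqI_infinite:
  fixes p q :: "'a::idom poly"
  assumes "infinite A" and "\<And>x. x \<in> A \<Longrightarrow> poly p x = poly q x"
  shows "p = q"
proof (rule ccontr)
  assume "p \<noteq> q"
  then have "finite {x. poly (p - q) x = 0}" by (intro poly_roots_finite) simp
  moreover have "A \<subseteq> {x. poly (p - q) x = 0}" using assms(2) by auto
  ultimately show False using assms(1) finite_subset by blast
qed

theorem mainTheorem8:
  fixes d a n :: nat
  assumes "d \<ge> 1"
  shows "X ^ n = (\<Sum>m=0..n. smult (S2hat d a n m) (fallfac d a X m))"
proof (rule poly_eqI_infinite)
  \<comment> \<open>Since d is nonzero, the progression a + d k supplies infinitely many distinct
    points.\<close>
  have "inj (\<lambda>k. of_nat (a + d * k) :: rat)"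
    using assms by (intro injI) (simp del: of_nat_add of_nat_mult)
  then show "infinite (range (\<lambda>k. of_nat (a + d * k) :: rat))"
    by (rule range_inj_infinite)
next
  fix y :: rat assume "y \<in> range (\<lambda>k. of_nat (a + d * k))"
  then obtain k where y: "y = of_nat (a + d * k)" by blast
  have pX: "poly X y = y" by (simp add: X_def)
  have "y ^ n = (\<Sum>m=0..n. S2 d a n m * fallfac 1 0 (of_nat k) m)"
    unfolding y by (rule normal_order_eval_X_power) (simp add: S2_normal_order)
  \<comment> \<open>The factor d^m from the progression cancels the denominator in
    \<open>S2hat\<close>, as d is nonzero.\<close>
  also have "\<dots> = (\<Sum>m=0..n. S2hat d a n m * fallfac d a y m)"
    using assms unfolding y fallfac_arith_progression by (simp add: S2hat_def)
  finally show "poly (X ^ n) y = poly (\<Sum>m=0..n. smult (S2hat d a n m) (fallfac d a X m)) y"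
    by (simp add: poly_sum poly_fallfac pX)
qed

end
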